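(* Let $k\subset L=k[x]$ be a finite Galois field extension. Then $k\subset L$ is distributive if and only if $k\subset L$ is cyclic (i.e. its Galois group is cyclic).
   Context: For a field extension $k\subset L$, $[k,L]$ denotes the set of all $k$-subalgebras of $L$ ordered by inclusion (for a finite extension these are the intermediate fields); it is a lattice with infimum $T\cap U$ and supremum the compositum $TU$. The extension is distributive if the lattice $[k,L]$ is distributive. *)

theory Defs
  imports "HOL-Algebra.Algebra"
begin

text \<open>
  A field extension is given by a field \<open>R\<close> (the top field) together with a subset \<open>K\<close> of its
  carrier such that \<open>subfield K R\<close>.
\<close>

section \<open>The lattice of subalgebras\<close>

text \<open>
  A unital subring of \<open>R\<close> is a \<open>K\<close>-subalgebra iff it contains \<open>K\<close>. The locale \<open>subalgebra\<close> of
  HOL-Algebra does not require closure under multiplication (its instances are the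
  \<open>K\<close>-subspaces), so it is not used here.
\<close>

definition subalgebras :: "('a, 'b) ring_scheme \<Rightarrow> 'a set \<Rightarrow> 'a set set"
  where "subalgebras R K = {T. subring T R \<and> K \<subseteq> T}"

definition subalgebra_order :: "('a, 'b) ring_scheme \<Rightarrow> 'a set \<Rightarrow> 'a set gorder"
  where "subalgebra_order R K = \<lparr>carrier = subalgebras R K, eq = (=), le = (\<subseteq>)\<rparr>"

definition distributive_lattice :: "('a, 'b) gorder_scheme \<Rightarrow> bool"
  where "distributive_lattice P \<longleftrightarrow> lattice P \<and>
    (\<forall>x\<in>carrier P. \<forall>y\<in>carrier P. \<forall>z\<in>carrier P.
       x \<sqinter>\<^bsub>P\<^esub> (y \<squnion>\<^bsub>P\<^esub> z) = (x \<sqinter>\<^bsub>P\<^esub> y) \<squnion>\<^bsub>P\<^esub> (x \<sqinter>\<^bsub>P\<^esub> z))"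

definition distributive_extension :: "('a, 'b) ring_scheme \<Rightarrow> 'a set \<Rightarrow> bool"
  where "distributive_extension R K \<longleftrightarrow> distributive_lattice (subalgebra_order R K)"

lemma (in ring) subalgebra_order_greatest:
  assumes "T \<in> subalgebras R K" "U \<in> subalgebras R K"
  shows "greatest (subalgebra_order R K) (T \<inter> U) (Lower (subalgebra_order R K) {T, U})"
proof -
  have "subring (T \<inter> U) R"
    using assms by (intro subringI) (auto simp: subalgebras_def subringE dest: subringE)
  thus ?thesis
    using assms by (auto simp: greatest_def Lower_def subalgebra_order_def subalgebras_def)
qed

lemma (in ring) subalgebra_order_least:
  assumes "T \<in> subalgebras R K" "U \<in> subalgebras R K"
  shows "least (subalgebra_order R K) (generate_ring R (T \<union> U))
           (Upper (subalgebra_order R K) {T, U})"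
proof -
  have sub: "T \<union> U \<subseteq> carrier R"
    using assms by (auto simp: subalgebras_def dest: subringE(1))
  show ?thesis
    using assms generate_ringE(1,2)[OF sub refl] generate_ring_min_subring1[OF sub]
    by (auto simp: least_def Upper_def subalgebra_order_def subalgebras_def)
qed

lemma partial_order_subalgebra_order: "partial_order (subalgebra_order R K)"
  by unfold_locales (auto simp: subalgebra_order_def)

lemma (in ring) lattice_subalgebra_order: "lattice (subalgebra_order R K)"
proof -
  interpret P: partial_order "subalgebra_order R K"
    by (rule partial_order_subalgebra_order)
  show ?thesis
  proof unfold_locales
    fix T U
    assume "T \<in> carrier (subalgebra_order R K)" "U \<in> carrier (subalgebra_order R K)"
    hence TU: "T \<in> subalgebras R K" "U \<in> subalgebras R K"
      by (simp_all add: subalgebra_order_def)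
    show "\<exists>s. least (subalgebra_order R K) s (Upper (subalgebra_order R K) {T, U})"
      using subalgebra_order_least[OF TU] by blast
    show "\<exists>s. greatest (subalgebra_order R K) s (Lower (subalgebra_order R K) {T, U})"
      using subalgebra_order_greatest[OF TU] by blast
  qed
qed

lemma (in ring) meet_subalgebra_order:
  assumes "T \<in> subalgebras R K" "U \<in> subalgebras R K"
  shows "T \<sqinter>\<^bsub>subalgebra_order R K\<^esub> U = T \<inter> U"
proof -
  interpret P: partial_order "subalgebra_order R K"
    by (rule partial_order_subalgebra_order)
  show ?thesis
    unfolding meet_def inf_def
    using subalgebra_order_greatest[OF assms] P.greatest_unique
    by (intro some_equality) blast+
qed

text \<open>
  The join is the compositum: for algebraic extensions the generated subring is a field.
\<close>

lemma (in ring) join_subalgebra_order: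
  assumes "T \<in> subalgebras R K" "U \<in> subalgebras R K"
  shows "T \<squnion>\<^bsub>subalgebra_order R K\<^esub> U = generate_ring R (T \<union> U)"
proof -
  interpret P: partial_order "subalgebra_order R K"
    by (rule partial_order_subalgebra_order)
  show ?thesis
    unfolding join_def sup_def
    using subalgebra_order_least[OF assms] P.least_unique
    by (intro some_equality) blast+
qed

section \<open>Galois extensions\<close>

definition (in ring) algebraic_extension :: "'a set \<Rightarrow> bool"
  where "algebraic_extension K \<longleftrightarrow> (\<forall>a\<in>carrier R. (algebraic over K) a)"

definition (in ring) normal_extension :: "'a set \<Rightarrow> bool"
  where "normal_extension K \<longleftrightarrow> algebraic_extension K \<and>
    (\<forall>p\<in>carrier (K[X]). pirreducible K p \<and> (\<exists>a. is_root p a) \<longrightarrow> splitted p)"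

text \<open>
  A polynomial is separable if it has no multiple root in an algebraic closure; here \<open>\<sigma>\<close> is the
  coefficientwise embedding of polynomials over \<open>R\<close> into polynomials over \<open>alg_closure\<close>.
\<close>

definition (in field) separable_poly :: "'a list \<Rightarrow> bool"
  where "separable_poly p \<longleftrightarrow>
    p \<noteq> [] \<and> (\<forall>b\<in>carrier alg_closure. ring.alg_mult alg_closure (\<sigma> p) b \<le> 1)"

definition (in field) separable_extension :: "'a set \<Rightarrow> bool"
  where "separable_extension K \<longleftrightarrow> algebraic_extension K \<and>
    (\<forall>a\<in>carrier R. separable_poly (Irr K a))"

definition (in field) galois_extension :: "'a set \<Rightarrow> bool"
  where "galois_extension K \<longleftrightarrow> normal_extension K \<and> separable_extension K"

text \<open>
  Automorphisms are taken to be extensional on the carrier, as in \<open>AutoGroup\<close>; otherwise one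
  field automorphism would be represented by many functions.
\<close>

definition galois_group :: "('a, 'b) ring_scheme \<Rightarrow> 'a set \<Rightarrow> ('a \<Rightarrow> 'a) monoid"
  where "galois_group R K = BijGroup (carrier R)
    \<lparr>carrier := {h \<in> ring_iso R R \<inter> extensional (carrier R). \<forall>k\<in>K. h k = k}\<rparr>"

lemma (in ring) group_galois_group:
  assumes "K \<subseteq> carrier R"
  shows "group (galois_group R K)"
proof -
  let ?A = "{h \<in> ring_iso R R \<inter> extensional (carrier R). \<forall>k\<in>K. h k = k}"
  have sub: "?A \<subseteq> Bij (carrier R)"
    by (auto simp: ring_iso_def Bij_def)
  have "subgroup ?A (BijGroup (carrier R))"
  proof (rule group.subgroupI[OF group_BijGroup])
    show "?A \<subseteq> carrier (BijGroup (carrier R))"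
      using sub by (simp add: BijGroup_def)
    have "(\<lambda>x\<in>carrier R. x) \<in> ?A"
      using assms by (auto simp: ring_iso_def ring_hom_def id_Bij[unfolded Bij_def, simplified]
          bij_betw_def inj_on_def)
    thus "?A \<noteq> {}" by blast
  next
    fix h assume h: "h \<in> ?A"
    hence hB: "h \<in> Bij (carrier R)" using sub by blast
    hence bij: "bij_betw h (carrier R) (carrier R)" by (simp add: Bij_def)
    let ?g = "\<lambda>y\<in>carrier R. inv_into (carrier R) h y"
    have "inv_into (carrier R) h \<in> ring_iso R R"
      using ring_iso_set_sym[OF ring_axioms] h by blast
    hence "?g \<in> ring_iso R R"
      by (intro ring_iso_memI) (auto simp: ring_iso_memE bij_betw_restrict_eq)
    moreover have "?g k = k" if "k \<in> K" for k
    proof -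
      have "k \<in> carrier R" "h k = k" using assms h that by auto
      thus ?thesis using bij_betw_inv_into_left[OF bij, of k] by simp
    qed
    ultimately have "?g \<in> ?A" by simp
    thus "inv\<^bsub>BijGroup (carrier R)\<^esub> h \<in> ?A"
      using inv_BijGroup[OF hB] by simp
  next
    fix g h assume g: "g \<in> ?A" and h: "h \<in> ?A"
    have "g \<circ> h \<in> ring_iso R R"
      using g h ring_iso_set_trans by blast
    hence "compose (carrier R) g h \<in> ring_iso R R"
      unfolding compose_def
      by (intro ring_iso_memI) (use ring_iso_memE[of "g \<circ> h" R R] in \<open>simp_all add: bij_betw_restrict_eq o_def\<close>)
    moreover have "compose (carrier R) g h k = k" if "k \<in> K" for k
      using assms g h that by (auto simp: compose_def)
    ultimately have "compose (carrier R) g h \<in> ?A"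
      by simp
    thus "g \<otimes>\<^bsub>BijGroup (carrier R)\<^esub> h \<in> ?A"
      using g h sub by (simp add: BijGroup_def subset_iff)
  qed
  thus ?thesis
    unfolding galois_group_def
    by (rule subgroup.subgroup_is_group[OF _ group_BijGroup])
qed

end

theory Submission
  imports Defs
begin

text \<open>
  Intermediate fields of a Galois extension correspond to subgroups of its Galois group \<open>G\<close>, with
  inclusion reversed, so the claim is about the lattice of subgroups of a finite group: it is
  distributive exactly when the group is cyclic (a theorem of Ore).

  The correspondence uses the primitive element \<open>x\<close>. An automorphism is determined by its value at
  \<open>x\<close>, and over an intermediate field \<open>T\<close> this value can be any root of the minimal polynomial of
  \<open>x\<close> over \<open>T\<close>, of which there are as many as its degree. An element fixed by all automorphisms
  over \<open>T\<close> is \<open>r(x)\<close> for a polynomial \<open>r\<close> over \<open>T\<close> of smaller degree; \<open>r\<close> is then constant on all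
  these roots, hence a constant polynomial, and the element lies in \<open>T\<close>
  (\<open>fixed_field_stabilizer\<close>). Conversely, the product of the \<open>X - h(x)\<close> over a subgroup \<open>H\<close> has
  coefficients fixed by \<open>H\<close>, so an automorphism over the fixed field of \<open>H\<close> permutes the \<open>h(x)\<close>
  and must belong to \<open>H\<close> (\<open>stabilizer_fixed_field\<close>).

  If \<open>G\<close> is cyclic with generator \<open>g\<close>, each subgroup consists of the \<open>g^n\<close> with \<open>n\<close> divisible by some
  fixed integer; product and intersection of subgroups become gcd and lcm, and these distribute over
  each other (\<open>cyclic_subgroups_distrib\<close>).

  If the lattice is distributive, then for all \<open>a, b \<in> G\<close> the cyclic group generated by \<open>a b\<close> is
  generated by its intersections with those generated by \<open>a\<close> and by \<open>b\<close>. Both intersections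
  commute with \<open>a\<close>, so \<open>a b\<close> does and \<open>G\<close> is abelian. A largest cyclic subgroup is then all of
  \<open>G\<close>: otherwise some element outside it has a prime power inside it, and either a larger cyclic
  subgroup exists or there are two cyclic subgroups with trivial intersection whose
  "diagonal" subgroup violates the condition (\<open>product_split_imp_cyclic\<close>).
\<close>

section \<open>Groups in which products split along cyclic subgroups\<close>

lemma (in group) subgroup_centralizer_of_element:
  assumes "g \<in> carrier G"
  shows "subgroup {z \<in> carrier G. z \<otimes> g = g \<otimes> z} G"
proof (rule subgroupI)
  show "{z \<in> carrier G. z \<otimes> g = g \<otimes> z} \<noteq> {}"
    using assms by (auto intro: exI[of _ \<one>])
next
  fix z assume z: "z \<in> {z \<in> carrier G. z \<otimes> g = g \<otimes> z}"
  hence "inv z \<otimes> g = inv z \<otimes> (g \<otimes> z) \<otimes> inv z"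
    using assms by (simp add: m_assoc)
  also have "\<dots> = inv z \<otimes> (z \<otimes> g) \<otimes> inv z"
    using z by simp
  also have "\<dots> = (inv z \<otimes> z) \<otimes> g \<otimes> inv z"
    using z assms by (simp only: m_assoc mem_Collect_eq inv_closed m_closed)
  also have "\<dots> = g \<otimes> inv z"
    using z assms by simp
  finally show "inv z \<in> {z \<in> carrier G. z \<otimes> g = g \<otimes> z}"
    using z by simp
next
  fix y z
  assume y: "y \<in> {z \<in> carrier G. z \<otimes> g = g \<otimes> z}" and z: "z \<in> {z \<in> carrier G. z \<otimes> g = g \<otimes> z}"
  have "y \<otimes> z \<otimes> g = y \<otimes> (g \<otimes> z)"
    using y z assms by (simp add: m_assoc)
  also have "\<dots> = y \<otimes> g \<otimes> z"
    using y z assms by (intro m_assoc[symmetric]) auto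
  also have "\<dots> = g \<otimes> y \<otimes> z"
    using y by simp
  also have "\<dots> = g \<otimes> (y \<otimes> z)"
    using y z assms by (simp add: m_assoc)
  finally show "y \<otimes> z \<in> {z \<in> carrier G. z \<otimes> g = g \<otimes> z}"
    using y z by simp
qed auto

lemma (in group) generate_singleton_commutes:
  assumes "g \<in> carrier G" "z \<in> generate G {g}"
  shows "z \<otimes> g = g \<otimes> z"
  using generate_subgroup_incl[OF _ subgroup_centralizer_of_element[OF assms(1)], of "{g}"] assms
  by auto

text \<open>
  An element of both \<open>generate G {a \<otimes> b}\<close> and \<open>generate G {b}\<close> commutes with \<open>a \<otimes> b\<close> and with \<open>b\<close>,
  hence with \<open>a\<close>; an element of \<open>generate G {a}\<close> does so trivially. Therefore \<open>a \<otimes> b\<close> commutes with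
  \<open>a\<close>, and cancelling \<open>a\<close> gives the claim. The hypothesis is what distributivity of the subgroup
  lattice says about the three cyclic subgroups, since \<open>a \<otimes> b\<close> lies in the join of the other two.
\<close>

lemma (in group) product_split_imp_commute:
  assumes a: "a \<in> carrier G" and b: "b \<in> carrier G"
    and split: "a \<otimes> b \<in> generate G (generate G {a \<otimes> b} \<inter> generate G {a} \<union>
                                   generate G {a \<otimes> b} \<inter> generate G {b})"
  shows "a \<otimes> b = b \<otimes> a"
proof -
  let ?Z = "\<lambda>g. {z \<in> carrier G. z \<otimes> g = g \<otimes> z}"
  have sub: "subgroup (?Z a) G"
    using subgroup_centralizer_of_element[OF a] .
  have in_carrier: "z \<in> carrier G" if "z \<in> generate G {g}" "g \<in> carrier G" for z g
    using generate_in_carrier[of "{g}"] that by simp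
  have "z \<otimes> a = a \<otimes> z" if "z \<in> generate G {a \<otimes> b}" "z \<in> generate G {b}" for z
  proof -
    have z: "z \<in> carrier G"
      using in_carrier that b by blast
    have "z \<otimes> a \<otimes> b = a \<otimes> b \<otimes> z"
      using generate_singleton_commutes[OF _ that(1)] a b z by (simp add: m_assoc)
    also have "\<dots> = a \<otimes> z \<otimes> b"
      using generate_singleton_commutes[OF b that(2)] a b z by (simp add: m_assoc)
    finally show ?thesis
      using a b z by simp
  qed
  hence "generate G {a \<otimes> b} \<inter> generate G {a} \<union> generate G {a \<otimes> b} \<inter> generate G {b} \<subseteq> ?Z a"
    using in_carrier a b generate_singleton_commutes by auto
  hence "a \<otimes> b \<in> ?Z a"
    using generate_subgroup_incl[OF _ sub] split by blast
  hence "a \<otimes> b \<otimes> a = a \<otimes> (a \<otimes> b)"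
    by simp
  thus ?thesis
    using a b by (simp add: m_assoc)
qed

lemma (in group) int_pow_in_generate:
  assumes "a \<in> carrier G"
  shows "a [^] (n::int) \<in> generate G {a}"
  using generate_pow[OF assms] by auto

lemma (in group) generate_singleton_subset:
  assumes "c \<in> carrier G" "a \<in> generate G {c}"
  shows "generate G {a} \<subseteq> generate G {c}"
  using generate_subgroup_incl[of "{a}" "generate G {c}"] generate_is_subgroup[of "{c}"] assms
  by simp

lemma (in group) Un_subset_set_mult:
  assumes "subgroup H G" "subgroup K G"
  shows "H \<union> K \<subseteq> H <#> K"
proof
  fix z assume z: "z \<in> H \<union> K"
  hence "z = z \<otimes> \<one>" "z = \<one> \<otimes> z"
    using assms subgroup.mem_carrier by fastforce+
  thus "z \<in> H <#> K"
    using z assms subgroup.one_closed unfolding set_mult_def by blast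
qed

text \<open>
  Raise \<open>b0\<close> to a maximal proper divisor of the least positive exponent that takes it into \<open>H\<close>.
\<close>

lemma (in group) prime_pow_into_subgroup:
  assumes fin: "finite (carrier G)" and H: "subgroup H G"
    and b0: "b0 \<in> carrier G" "b0 \<notin> H"
  obtains p b where "Factorial_Ring.prime (p::nat)" "b \<in> carrier G" "b \<notin> H" "b [^] p \<in> H"
proof -
  define n where "n = (LEAST n::nat. n > 0 \<and> b0 [^] n \<in> H)"
  have "ord b0 > 0 \<and> b0 [^] ord b0 \<in> H"
    using ord_ge_1[OF fin b0(1)] b0(1) subgroup.one_closed[OF H] by simp
  hence "\<exists>n::nat. n > 0 \<and> b0 [^] n \<in> H"
    by blast
  hence n: "n > 0" "b0 [^] n \<in> H"
    using LeastI_ex[of "\<lambda>n::nat. n > 0 \<and> b0 [^] n \<in> H"] unfolding n_def by auto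
  have least: "b0 [^] m \<notin> H" if "0 < m" "m < n" for m
    using not_less_Least[of m "\<lambda>n. n > 0 \<and> b0 [^] n \<in> H"] that unfolding n_def by blast
  have "n \<noteq> 1"
    using n b0 by auto
  then obtain p where p: "Factorial_Ring.prime p" "p dvd n"
    using prime_factor_nat by blast
  then obtain m where m: "n = m * p"
    by (metis dvdE mult.commute)
  have "m > 0" "m < n"
    using m n(1) prime_gt_1_nat[OF p(1)] by auto
  hence "b0 [^] m \<notin> H"
    using least by blast
  moreover have "(b0 [^] m) [^] p \<in> H"
    using n(2) m b0(1) by (simp add: nat_pow_pow)
  ultimately show thesis
    using that p(1) b0(1) by blast
qed

text \<open>
  Let \<open>a\<close> generate a largest cyclic subgroup, and suppose that \<open>b\<close> lies outside it while
  \<open>b [^] p = a [^] m\<close> for a prime \<open>p\<close>. If \<open>p\<close> does not divide \<open>m\<close>, a Bezout combination of \<open>a\<close> and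
  \<open>b\<close> generates both of them. If it does, dividing \<open>b\<close> by a power of \<open>a\<close> gives an element \<open>d\<close> of
  order \<open>p\<close>, whose powers meet those of \<open>a\<close> only in \<open>\<one>\<close>; splitting \<open>a \<otimes> d\<close> is then possible only
  as \<open>a\<close> times \<open>d\<close>, so \<open>a \<otimes> d\<close> generates both. Either way maximality is violated.
\<close>

lemma (in group) product_split_imp_cyclic:
  assumes fin: "finite (carrier G)"
    and split: "\<And>a b. \<lbrakk>a \<in> carrier G; b \<in> carrier G\<rbrakk> \<Longrightarrow>
      a \<otimes> b \<in> generate G (generate G {a \<otimes> b} \<inter> generate G {a} \<union>
                        generate G {a \<otimes> b} \<inter> generate G {b})"
  shows "cyclic_group G"
proof -
  interpret comm_group G
    using product_split_imp_commute split by (intro group_comm_groupI) blast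
  have sub: "subgroup (generate G {g}) G" if "g \<in> carrier G" for g
    using generate_is_subgroup[of "{g}"] that by simp
  have fin_gen: "finite (generate G {g})" if "g \<in> carrier G" for g
    using generate_incl[of "{g}"] that fin finite_subset by auto
  have self: "g \<in> generate G {g}" for g
    by (simp add: generate.incl)
  define M where "M = Max ((\<lambda>c. card (generate G {c})) ` carrier G)"
  have "M \<in> (\<lambda>c. card (generate G {c})) ` carrier G"
    unfolding M_def using fin carrier_not_empty by (intro Max_in) auto
  then obtain a where a: "a \<in> carrier G" and "M = card (generate G {a})"
    by blast
  hence max: "card (generate G {c}) \<le> card (generate G {a})" if "c \<in> carrier G" for c
    unfolding M_def using fin that Max_ge[of "(\<lambda>c. card (generate G {c})) ` carrier G"] by auto
  have maximal: "b \<in> generate G {a}" if "c \<in> carrier G" "a \<in> generate G {c}" "b \<in> generate G {c}" for b c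
    using card_seteq[OF fin_gen[OF that(1)] generate_singleton_subset[OF that(1,2)] max[OF that(1)]]
      that(3) by simp
  have "b0 \<in> generate G {a}" if b0: "b0 \<in> carrier G" for b0
  proof (rule ccontr)
    assume "b0 \<notin> generate G {a}"
    then obtain p b where p: "Factorial_Ring.prime (p::nat)"
      and b: "b \<in> carrier G" "b \<notin> generate G {a}" "b [^] p \<in> generate G {a}"
      using prime_pow_into_subgroup[OF fin sub[OF a] b0] by blast
    then obtain m :: int where m: "b [^] p = a [^] m"
      using generate_pow[OF a] by auto
    hence m': "b [^] (int p) = a [^] m"
      by (simp add: int_pow_int)
    have p': "Factorial_Ring.prime (int p)"
      using p by simp
    show False
    proof (cases "int p dvd m")
      case False
      hence "coprime (int p) m"
        using p' prime_imp_coprime by blast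
      then obtain u v where uv: "u * int p + v * m = 1"
        by (metis bezout_int coprime_imp_gcd_eq_1)
      \<comment> \<open>This choice makes \<open>c [^] p = a\<close> and \<open>c [^] m = b\<close>.\<close>
      define c where "c = a [^] u \<otimes> b [^] v"
      have c: "c \<in> carrier G"
        using a b unfolding c_def by simp
      have "c [^] int p = a [^] (u * int p) \<otimes> (b [^] int p) [^] v"
        using a b unfolding c_def by (simp add: int_pow_distrib int_pow_pow mult.commute)
      also have "\<dots> = a [^] (u * int p + v * m)"
        using a by (simp add: m' int_pow_pow int_pow_mult mult.commute)
      finally have "a = c [^] int p"
        using a uv by simp
      hence a_mem: "a \<in> generate G {c}"
        using int_pow_in_generate[OF c] by metis
      have "c [^] m = (a [^] m) [^] u \<otimes> b [^] (v * m)"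
        using a b unfolding c_def by (simp add: int_pow_distrib int_pow_pow mult.commute)
      also have "\<dots> = b [^] (u * int p + v * m)"
        using b by (simp add: m'[symmetric] int_pow_pow int_pow_mult mult.commute)
      finally have "b = c [^] m"
        using b uv by simp
      hence "b \<in> generate G {c}"
        using int_pow_in_generate[OF c] by metis
      thus False
        using maximal[OF c a_mem] b(2) by blast
    next
      case True
      then obtain t where t: "m = int p * t"
        by blast
      define d where "d = b \<otimes> a [^] (- t)"
      have d: "d \<in> carrier G"
        using a b unfolding d_def by simp
      have "b = d \<otimes> a [^] t"
        using a b unfolding d_def by (simp add: m_assoc int_pow_mult[symmetric])
      hence d_notin: "d \<notin> generate G {a}"
        using b(2) int_pow_in_generate[OF a] subgroup.m_closed[OF sub[OF a]] by metis
      have "d [^] int p = a [^] m \<otimes> a [^] (- m)"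
        using a b m' unfolding d_def t by (simp add: int_pow_distrib int_pow_pow mult.commute)
      hence d_pow: "d [^] int p = \<one>"
        using a by (simp add: int_pow_mult[symmetric])
      \<comment> \<open>As \<open>p\<close> is prime, a nontrivial power of \<open>d\<close> has \<open>d\<close> among its powers.\<close>
      have disjoint: "e = \<one>" if e: "e \<in> generate G {a}" "e \<in> generate G {d}" for e
      proof -
        obtain j :: int where j: "e = d [^] j"
          using e(2) generate_pow[OF d] by auto
        have "int p dvd j"
        proof (rule ccontr)
          assume "\<not> int p dvd j"
          hence "coprime (int p) j"
            using p' prime_imp_coprime by blast
          then obtain u v where uv: "u * int p + v * j = 1"
            by (metis bezout_int coprime_imp_gcd_eq_1)
          have "d = d [^] (u * int p + v * j)"
            using d uv by simp
          also have "\<dots> = (d [^] int p) [^] u \<otimes> e [^] v"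
            using d j by (simp add: int_pow_pow int_pow_mult mult.commute)
          also have "\<dots> = e [^] v"
            using d d_pow j by simp
          finally have "d = e [^] v" .
          moreover have "e \<in> carrier G"
            using d j by simp
          ultimately show False
            using d_notin generate_singleton_subset[OF a e(1)] int_pow_in_generate
            by blast
        qed
        then obtain i where "j = int p * i" by blast
        thus ?thesis
          using d d_pow j by (simp add: int_pow_pow[symmetric])
      qed
      let ?N = "generate G {a \<otimes> d}"
      have ad: "a \<otimes> d \<in> carrier G"
        using a d by simp
      have "subgroup ((?N \<inter> generate G {a}) <#> (?N \<inter> generate G {d})) G"
        using mult_subgroups subgroups_Inter_pair sub a d ad by simp
      moreover have "?N \<inter> generate G {a} \<union> ?N \<inter> generate G {d} \<subseteq>
          (?N \<inter> generate G {a}) <#> (?N \<inter> generate G {d})"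
        using Un_subset_set_mult subgroups_Inter_pair sub a d ad by blast
      ultimately have "a \<otimes> d \<in> (?N \<inter> generate G {a}) <#> (?N \<inter> generate G {d})"
        using generate_subgroup_incl split[OF a d] by blast
      then obtain g h where gh: "g \<in> ?N" "g \<in> generate G {a}" "h \<in> ?N" "h \<in> generate G {d}"
        "a \<otimes> d = g \<otimes> h"
        unfolding set_mult_def by blast
      have gh_carrier: "g \<in> carrier G" "h \<in> carrier G"
        using generate_in_carrier[OF _ gh(2)] generate_in_carrier[OF _ gh(4)] a d by auto
      \<comment> \<open>The quotient of the two factorizations lies in both cyclic subgroups, so they agree.\<close>
      have "inv g \<otimes> a = inv g \<otimes> (a \<otimes> d) \<otimes> inv d"
        using a d gh_carrier by (simp add: m_assoc)
      also have "\<dots> = h \<otimes> inv d"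
        using a d gh_carrier by (simp add: gh(5) m_assoc[symmetric])
      finally have eq: "inv g \<otimes> a = h \<otimes> inv d" .
      have "inv g \<otimes> a \<in> generate G {a}"
        using subgroup.m_closed[OF sub[OF a]] subgroup.m_inv_closed[OF sub[OF a]] gh(2) self by blast
      moreover have "inv g \<otimes> a \<in> generate G {d}"
        unfolding eq
        using subgroup.m_closed[OF sub[OF d]] subgroup.m_inv_closed[OF sub[OF d]] gh(4) self by blast
      ultimately have "inv g \<otimes> a = \<one>" "h \<otimes> inv d = \<one>"
        using disjoint eq by auto
      hence "a = g" "d = h"
        using a d gh_carrier by (metis inv_closed inv_equality inv_inv, metis inv_closed inv_equality inv_inv)
      thus False
        using maximal[OF ad, of d] gh d_notin by simp
    qed
  qed
  hence "carrier G = range (\<lambda>n::int. a [^] n)"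
    using generate_pow[OF a] a by auto
  thus ?thesis
    using a cyclic_group by blast
qed

section \<open>Subgroups of a cyclic group\<close>

text \<open>
  The exponents \<open>n\<close> with \<open>g [^] n \<in> H\<close> form a subgroup of the integers; \<open>d = 0\<close> covers the case that
  it is trivial.
\<close>

lemma (in group) exponents_into_subgroup:
  assumes H: "subgroup H G" and g: "g \<in> carrier G"
  obtains d :: int where "\<And>n::int. g [^] n \<in> H \<longleftrightarrow> d dvd n"
proof (cases "\<exists>n::nat. n > 0 \<and> g [^] n \<in> H")
  case False
  have "g [^] n \<in> H \<longleftrightarrow> 0 dvd n" for n :: int
  proof
    assume n: "g [^] n \<in> H"
    hence "g [^] \<bar>n\<bar> \<in> H"
      using subgroup.m_inv_closed[OF H] g by (cases "n \<ge> 0") (auto simp: int_pow_neg)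
    hence "g [^] nat \<bar>n\<bar> \<in> H"
      using int_pow_int[of G g "nat \<bar>n\<bar>"] by simp
    hence "nat \<bar>n\<bar> = 0" using False gr0I by metis
    thus "0 dvd n" by simp
  next
    assume "0 dvd n" thus "g [^] n \<in> H"
      using subgroup.one_closed[OF H] by simp
  qed
  thus thesis using that by blast
next
  case True
  define d where "d = (LEAST n::nat. n > 0 \<and> g [^] n \<in> H)"
  have d: "d > 0" "g [^] d \<in> H"
    using LeastI_ex[OF True] unfolding d_def by auto
  have least: "g [^] m \<notin> H" if "0 < m" "m < d" for m
    using not_less_Least[of m "\<lambda>n. n > 0 \<and> g [^] n \<in> H"] that unfolding d_def by blast
  have mult: "g [^] (int d * q) \<in> H" for q
    using subgroup_int_pow_closed[OF H d(2), of q] int_pow_pow[OF g, of "int d" q]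
    by (simp add: int_pow_int mult.commute)
  have "g [^] n \<in> H \<longleftrightarrow> int d dvd n" for n :: int
  proof
    assume n: "g [^] n \<in> H"
    have "g [^] (n mod int d) = g [^] n \<otimes> g [^] (int d * - (n div int d))"
      using g by (simp add: int_pow_mult[symmetric] minus_mult_div_eq_mod[symmetric])
    hence "g [^] (n mod int d) \<in> H"
      using subgroup.m_closed[OF H n mult[of "- (n div int d)"]] by simp
    hence "g [^] (nat (n mod int d)) \<in> H"
      using int_pow_int[of G g "nat (n mod int d)"] d(1) by simp
    moreover have "nat (n mod int d) < d"
      using d(1) by (simp add: nat_less_iff)
    ultimately have "nat (n mod int d) = 0"
      using least by blast
    thus "int d dvd n"
      using pos_mod_sign[of "int d" n] d(1) by (intro mod_0_imp_dvd) linarith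
  next
    assume "int d dvd n" thus "g [^] n \<in> H" using mult by auto
  qed
  thus thesis using that by blast
qed

text \<open>
  Describe each subgroup by the exponents of a generator, as the multiples of one integer. The product
  \<open>A <#> B\<close> then belongs to the gcd and \<open>B \<inter> C\<close> to the lcm, so the claim is the distributivity of gcd
  over lcm, with Bezout coefficients providing the factorization.
\<close>

lemma (in group) cyclic_subgroups_distrib:
  assumes cyc: "cyclic_group G"
    and A: "subgroup A G" and B: "subgroup B G" and C: "subgroup C G"
  shows "(A <#> B) \<inter> (A <#> C) \<subseteq> A <#> (B \<inter> C)"
proof
  obtain g where g: "g \<in> carrier G" and gen: "carrier G = range (\<lambda>n::int. g [^] n)"
    using cyc cyclic_group by blast
  obtain \<alpha> where \<alpha>: "\<And>n::int. g [^] n \<in> A \<longleftrightarrow> \<alpha> dvd n"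
    using exponents_into_subgroup[OF A g] by blast
  obtain \<beta> where \<beta>: "\<And>n::int. g [^] n \<in> B \<longleftrightarrow> \<beta> dvd n"
    using exponents_into_subgroup[OF B g] by blast
  obtain \<gamma> where \<gamma>: "\<And>n::int. g [^] n \<in> C \<longleftrightarrow> \<gamma> dvd n"
    using exponents_into_subgroup[OF C g] by blast
  have dvd: "gcd \<alpha> \<delta> dvd n"
    if D: "subgroup D G" and \<delta>: "\<And>n::int. g [^] n \<in> D \<longleftrightarrow> \<delta> dvd n" and n: "g [^] n \<in> A <#> D"
    for D \<delta> n
  proof -
    obtain h k where hk: "h \<in> A" "k \<in> D" "g [^] n = h \<otimes> k"
      using n unfolding set_mult_def by blast
    have carr: "h \<in> carrier G" "k \<in> carrier G"
      using hk A D subgroup.subset by blast+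
    obtain i :: int where i: "h = g [^] i"
      using gen carr(1) by blast
    have "g [^] (n - i) = inv h \<otimes> (h \<otimes> k)"
      using g i hk(3) by (metis add.commute diff_conv_add_uminus int_pow_mult int_pow_neg)
    also have "\<dots> = k"
      using carr by (simp add: m_assoc[symmetric])
    finally have "g [^] (n - i) \<in> D"
      using hk(2) by simp
    hence "\<alpha> dvd i" "\<delta> dvd n - i"
      using \<alpha> \<delta> hk(1) i by auto
    thus ?thesis
      by (metis diff_add_cancel dvd_add dvd_trans gcd_dvd1 gcd_dvd2)
  qed
  fix z assume z: "z \<in> (A <#> B) \<inter> (A <#> C)"
  hence "z \<in> carrier G"
    using set_mult_closed A B subgroup.subset by blast
  then obtain n :: int where n: "z = g [^] n"
    using gen by blast
  have "gcd \<alpha> \<beta> dvd n" "gcd \<alpha> \<gamma> dvd n"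
    using dvd[OF B \<beta>] dvd[OF C \<gamma>] z n by auto
  hence "gcd \<alpha> (lcm \<beta> \<gamma>) dvd n"
    by (simp add: gcd_lcm_distrib)
  moreover obtain u v where "u * \<alpha> + v * lcm \<beta> \<gamma> = gcd \<alpha> (lcm \<beta> \<gamma>)"
    using bezout_int by blast
  ultimately obtain w where "n = w * (u * \<alpha> + v * lcm \<beta> \<gamma>)"
    by (metis dvdE mult.commute)
  hence "z = g [^] (w * u * \<alpha>) \<otimes> g [^] (w * v * lcm \<beta> \<gamma>)"
    using n g by (simp add: int_pow_mult[symmetric] algebra_simps)
  moreover have "g [^] (w * u * \<alpha>) \<in> A" "g [^] (w * v * lcm \<beta> \<gamma>) \<in> B \<inter> C"
    using \<alpha> \<beta> \<gamma> by (auto intro: dvd_mult)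
  ultimately show "z \<in> A <#> (B \<inter> C)"
    unfolding set_mult_def by blast
qed

section \<open>Homomorphisms over a base field\<close>

text \<open>
  The inverse of an algebraic element \<open>a\<close> is a polynomial in \<open>a\<close>, so any subring with \<open>a\<close> and \<open>K\<close>
  contains it.
\<close>

lemma (in field) subring_of_algebraic_extension_is_subfield:
  assumes K: "subfield K R" and alg: "algebraic_extension K"
    and T: "subring T R" "K \<subseteq> T"
  shows "subfield T R"
proof (rule subfieldI'[OF T(1)])
  fix a assume a: "a \<in> T - {\<zero>}"
  hence aR: "a \<in> carrier R"
    using subringE(1)[OF T(1)] by blast
  have "subfield (simple_extension K a) R"
    using simple_extension_is_subfield[OF K aR] alg aR unfolding algebraic_extension_def by blast
  hence "inv a \<in> simple_extension K a"
    using subfield_m_inv(1)[of _ a] simple_extension_mem[OF subfieldE(1)[OF K] aR] a by blast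
  thus "inv a \<in> T"
    using simple_extension_subring_incl[OF T, of a] a by blast
qed

lemma (in field) hom_fixing_eval:
  assumes "subring K R" "\<phi> \<in> ring_hom R R" "\<And>c. c \<in> K \<Longrightarrow> \<phi> c = c"
    and "p \<in> carrier (K[X])" "y \<in> carrier R"
  shows "\<phi> (eval p y) = eval p (\<phi> y)"
proof -
  interpret \<phi>: ring_hom_ring R R \<phi>
    using ring_hom_ringI2[OF ring_axioms ring_axioms assms(2)] .
  have "set p \<subseteq> K"
    using assms(4) polynomial_incl univ_poly_carrier by blast
  hence "map \<phi> p = p"
    using assms(3) by (intro map_idI) auto
  thus ?thesis
    using \<phi>.eval_hom[OF assms(1,5,4)] by simp
qed

text \<open>
  A homomorphism of fields is injective. As \<open>\<phi>\<close> fixes \<open>K\<close>, it permutes the finitely many roots of the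
  minimal polynomial of any \<open>z\<close> over \<open>K\<close>; since \<open>z\<close> is one of these roots, it is in the image.
\<close>

lemma (in field) hom_fixing_subfield_is_bij:
  assumes K: "subfield K R" and alg: "algebraic_extension K"
    and \<phi>: "\<phi> \<in> ring_hom R R" and fix_K: "\<And>c. c \<in> K \<Longrightarrow> \<phi> c = c"
  shows "bij_betw \<phi> (carrier R) (carrier R)"
proof -
  have inj: "inj_on \<phi> (carrier R)"
    using non_trivial_field_hom_is_inj[OF \<phi> field_axioms field_axioms] .
  moreover have "z \<in> \<phi> ` carrier R" if z: "z \<in> carrier R" for z
  proof -
    have alg_z: "(algebraic over K) z"
      using alg z unfolding algebraic_extension_def by blast
    let ?p = "Irr K z"
    let ?S = "{y. is_root ?p y}"
    note p = IrrE[OF K z alg_z]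
    have p_ne: "?p \<noteq> []"
      using pirreducibleE(1)[OF subfieldE(1)[OF K] p(1,2)] .
    have sub: "?S \<subseteq> carrier R"
      unfolding is_root_def by blast
    have "\<phi> y \<in> ?S" if "y \<in> ?S" for y
    proof -
      have y: "y \<in> carrier R" "eval ?p y = \<zero>"
        using that unfolding is_root_def by auto
      have "eval ?p (\<phi> y) = \<phi> (eval ?p y)"
        using hom_fixing_eval[OF subfieldE(1)[OF K] \<phi> fix_K p(1) y(1)] by simp
      also have "\<dots> = \<zero>"
        using y(2) ring_hom_zero[OF \<phi> ring_axioms ring_axioms] by simp
      finally show ?thesis
        using ring_hom_memE(1)[OF \<phi> y(1)] p_ne unfolding is_root_def by simp
    qed
    hence "\<phi> ` ?S \<subseteq> ?S"
      by blast
    moreover have "finite ?S"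
      using finite_number_of_roots carrier_polynomial_shell[OF subfieldE(1)[OF K] p(1)] by blast
    ultimately have "\<phi> ` ?S = ?S"
      using endo_inj_surj inj_on_subset[OF inj sub] by blast
    moreover have "z \<in> ?S"
      using z p(4) p_ne unfolding is_root_def by simp
    ultimately show ?thesis
      using sub by blast
  qed
  ultimately show ?thesis
    using ring_hom_memE(1)[OF \<phi>] unfolding bij_betw_def by blast
qed

lemma carrier_galois_group:
  "carrier (galois_group R K) = {h \<in> ring_iso R R \<inter> extensional (carrier R). \<forall>c\<in>K. h c = c}"
  by (simp add: galois_group_def)

text \<open>
  Every element is \<open>p(x)\<close> for a polynomial \<open>p\<close> over \<open>K\<close>; the automorphism sends it to \<open>p(y)\<close>. This is
  well defined because the minimal polynomial of \<open>x\<close> also vanishes at \<open>y\<close>.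
\<close>

lemma (in field) exists_automorphism_to_conjugate:
  assumes K: "subfield K R" and alg: "algebraic_extension K"
    and x: "x \<in> carrier R" and prim: "carrier R = simple_extension K x"
    and y: "is_root (Irr K x) y"
  shows "\<exists>\<phi>\<in>carrier (galois_group R K). \<phi> x = y"
proof -
  have sub: "subring K R"
    using subfieldE(1)[OF K] .
  have yR: "y \<in> carrier R" "eval (Irr K x) y = \<zero>"
    using y unfolding is_root_def by auto
  have alg_x: "(algebraic over K) x"
    using alg x unfolding algebraic_extension_def by blast
  note irr = IrrE[OF K x alg_x]
  interpret KX: cring "K[X]"
    using univ_poly_is_cring[OF sub] .
  interpret ex: ring_hom_cring "K[X]" R "\<lambda>p. eval p x"
    using eval_cring_hom[OF sub x] .
  interpret ey: ring_hom_cring "K[X]" R "\<lambda>p. eval p y"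
    using eval_cring_hom[OF sub yR(1)] .
  \<comment> \<open>Two polynomials with the same value at \<open>x\<close> differ by a multiple of its minimal polynomial.\<close>
  have well_defined: "eval p y = eval q y"
    if p: "p \<in> carrier (K[X])" and q: "q \<in> carrier (K[X])" and eq: "eval p x = eval q x" for p q
  proof -
    have pq: "p \<ominus>\<^bsub>K[X]\<^esub> q \<in> carrier (K[X])"
      using p q by simp
    have "eval (p \<ominus>\<^bsub>K[X]\<^esub> q) x = \<zero>"
      using p q eq by (simp add: KX.minus_eq) (metis q ex.hom_closed r_neg)
    hence "Irr K x pdivides (p \<ominus>\<^bsub>K[X]\<^esub> q)"
      using Irr_minimal[OF K x alg_x pq] by simp
    hence "eval (p \<ominus>\<^bsub>K[X]\<^esub> q) y = \<zero>"
      using pdivides_imp_root_sharing carrier_polynomial_shell[OF sub irr(1)] yR by blast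
    hence "eval p y \<ominus> eval q y = \<zero>"
      using p q by (simp add: KX.minus_eq minus_eq)
    thus ?thesis
      using p q by (simp add: r_right_minus_eq)
  qed
  define rep where "rep a = (SOME p. p \<in> carrier (K[X]) \<and> eval p x = a)" for a
  have rep: "rep a \<in> carrier (K[X])" "eval (rep a) x = a" if "a \<in> carrier R" for a
  proof -
    have "a \<in> (\<lambda>p. eval p x) ` carrier (K[X])"
      using that prim simple_extension_as_eval_img[OF subfieldE(3)[OF K] x] by simp
    hence "\<exists>p. p \<in> carrier (K[X]) \<and> eval p x = a"
      by blast
    from someI_ex[OF this] show "rep a \<in> carrier (K[X])" "eval (rep a) x = a"
      unfolding rep_def by simp_all
  qed
  define \<phi> where "\<phi> = (\<lambda>a\<in>carrier R. eval (rep a) y)"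
  have \<phi>_eval: "\<phi> (eval p x) = eval p y" if "p \<in> carrier (K[X])" for p
  proof -
    have px: "eval p x \<in> carrier R"
      using ex.hom_closed[OF that] .
    hence "\<phi> (eval p x) = eval (rep (eval p x)) y"
      by (simp add: \<phi>_def)
    also have "\<dots> = eval p y"
      using well_defined[OF rep(1)[OF px] that rep(2)[OF px]] .
    finally show ?thesis .
  qed
  have "\<phi> \<in> ring_hom R R"
  proof (rule ring_hom_memI)
    fix a b assume a: "a \<in> carrier R" and b: "b \<in> carrier R"
    show "\<phi> a \<in> carrier R"
      using a rep(1)[OF a] by (simp add: \<phi>_def)
    have "\<phi> (a \<otimes> b) = \<phi> (eval (rep a \<otimes>\<^bsub>K[X]\<^esub> rep b) x)"
      using a b rep by simp
    also have "\<dots> = \<phi> a \<otimes> \<phi> b"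
      using a b rep by (subst \<phi>_eval) (simp_all add: \<phi>_def)
    finally show "\<phi> (a \<otimes> b) = \<phi> a \<otimes> \<phi> b" .
    have "\<phi> (a \<oplus> b) = \<phi> (eval (rep a \<oplus>\<^bsub>K[X]\<^esub> rep b) x)"
      using a b rep by simp
    also have "\<dots> = \<phi> a \<oplus> \<phi> b"
      using a b rep by (subst \<phi>_eval) (simp_all add: \<phi>_def)
    finally show "\<phi> (a \<oplus> b) = \<phi> a \<oplus> \<phi> b" .
  next
    show "\<phi> \<one> = \<one>"
      using \<phi>_eval[of "\<one>\<^bsub>K[X]\<^esub>"] by simp
  qed
  moreover have fix_K: "\<phi> c = c" if c: "c \<in> K" for c
  proof -
    have "c \<in> carrier R"
      using c subfieldE(3)[OF K] by blast
    moreover have "normalize [c] \<in> carrier (K[X])"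
      using c normalize_gives_polynomial[of "[c]" K] univ_poly_carrier by auto
    ultimately show ?thesis
      using \<phi>_eval[of "normalize [c]"] x yR(1) eval_normalize[of "[c]"] by simp
  qed
  ultimately have "\<phi> \<in> carrier (galois_group R K)"
    using hom_fixing_subfield_is_bij[OF K alg, of \<phi>]
    unfolding carrier_galois_group ring_iso_def by (simp add: \<phi>_def)
  moreover have "\<phi> x = y"
    using \<phi>_eval[OF var_closed(1)[OF sub]] eval_var x yR(1) by simp
  ultimately show ?thesis
    by blast
qed

section \<open>Roots of polynomials\<close>

lemma (in domain) finprod_eq_zero_imp_factor_zero:
  assumes "finite F" "g \<in> F \<rightarrow> carrier R" "(\<Otimes>i\<in>F. g i) = \<zero>"
  shows "\<exists>i\<in>F. g i = \<zero>"
  using assms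
proof (induction F rule: finite_induct)
  case (insert i F)
  have "g i \<otimes> (\<Otimes>j\<in>F. g j) = \<zero>"
    using insert by (simp add: Pi_def)
  hence "g i = \<zero> \<or> (\<Otimes>j\<in>F. g j) = \<zero>"
    using insert.prems(1) integral_iff by (simp add: Pi_def)
  thus ?case
    using insert by auto
qed simp

text \<open>
  Injectivity of a homomorphism of fields keeps leading coefficients nonzero, so applying it to the
  coefficients needs no renormalization.
\<close>

lemma map_poly_ring_hom:
  assumes h: "h \<in> ring_hom R S" and R: "field R" and S: "field S"
  shows "ring_hom_cring (poly_ring R) (poly_ring S) (map h)"
proof -
  interpret R: field R by fact
  interpret S: field S by fact
  interpret h: ring_hom_ring R S h
    using ring_hom_ringI2[OF R.ring_axioms S.ring_axioms h] .
  have carrier: "map h p \<in> carrier (poly_ring S)" if "p \<in> carrier (poly_ring R)" for p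
    using polynomial_hom[OF h R S that] .
  have set: "set p \<subseteq> carrier R" if "p \<in> carrier (poly_ring R)" for p
    using that R.polynomial_incl univ_poly_carrier by blast
  have norm: "S.normalize (map h p) = map h p" if "p \<in> carrier (poly_ring R)" for p
    using S.normalize_polynomial carrier[OF that] univ_poly_carrier by blast
  interpret RX: cring "poly_ring R"
    using R.univ_poly_is_cring[OF R.carrier_is_subring] .
  interpret SX: cring "poly_ring S"
    using S.univ_poly_is_cring[OF S.carrier_is_subring] .
  have "map h \<in> ring_hom (poly_ring R) (poly_ring S)"
  proof (rule ring_hom_memI)
    fix p q assume p: "p \<in> carrier (poly_ring R)" and q: "q \<in> carrier (poly_ring R)"
    show "map h p \<in> carrier (poly_ring S)"
      using carrier[OF p] .
    show "map h (p \<otimes>\<^bsub>poly_ring R\<^esub> q) = map h p \<otimes>\<^bsub>poly_ring S\<^esub> map h q"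
      using h.poly_mult_hom'[OF set[OF p] set[OF q]] norm[OF RX.m_closed[OF p q]]
      by (simp add: univ_poly_mult)
    show "map h (p \<oplus>\<^bsub>poly_ring R\<^esub> q) = map h p \<oplus>\<^bsub>poly_ring S\<^esub> map h q"
      using h.poly_add_hom'[OF set[OF p] set[OF q]] norm[OF RX.a_closed[OF p q]]
      by (simp add: univ_poly_add)
  next
    show "map h \<one>\<^bsub>poly_ring R\<^esub> = \<one>\<^bsub>poly_ring S\<^esub>"
      by (simp add: univ_poly_one)
  qed
  thus ?thesis
    by unfold_locales
qed

lemma (in domain) monic_linear_in_carrier:
  assumes "a \<in> carrier R"
  shows "[\<one>, \<ominus> a] \<in> carrier (poly_ring R)"
  using assms by (simp add: univ_poly_carrier[symmetric] polynomial_def)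

text \<open>
  Separability speaks about multiplicities in the algebraic closure. The embedding carries the power
  of \<open>X - a\<close> that divides \<open>p\<close> to the same power of a linear factor of the image of \<open>p\<close>, so
  multiplicities do not decrease.
\<close>

lemma (in field) alg_mult_le_1_of_separable_poly:
  assumes p: "p \<in> carrier (poly_ring R)" and sep: "separable_poly p"
  shows "alg_mult p a \<le> 1"
proof (cases "a \<in> carrier R")
  case False
  thus ?thesis by (simp add: alg_mult_def)
next
  case a: True
  interpret A: algebraic_closure alg_closure "indexed_const ` carrier R"
    using alg_closureE(1) .
  interpret h: ring_hom_ring R alg_closure indexed_const
    using ring_hom_ringI2[OF ring_axioms A.ring_axioms alg_closureE(2)] .
  interpret H: ring_hom_cring "poly_ring R" "poly_ring alg_closure" "map indexed_const"
    using map_poly_ring_hom[OF alg_closureE(2) field_axioms A.field_axioms] .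
  let ?X = "[\<one>, \<ominus> a]"
  note X = monic_linear_in_carrier[OF a]
  have ne: "p \<noteq> []"
    using sep unfolding separable_poly_def by simp
  have "?X [^]\<^bsub>poly_ring R\<^esub> alg_mult p a pdivides p"
    using alg_multE(1)[OF a p ne] .
  then obtain q where q: "q \<in> carrier (poly_ring R)"
    and p_eq: "p = ?X [^]\<^bsub>poly_ring R\<^esub> alg_mult p a \<otimes>\<^bsub>poly_ring R\<^esub> q"
    unfolding pdivides_def factor_def by blast
  have "map indexed_const p =
      map indexed_const ?X [^]\<^bsub>poly_ring alg_closure\<^esub> alg_mult p a
        \<otimes>\<^bsub>poly_ring alg_closure\<^esub> map indexed_const q"
    using p_eq X q H.hom_mult H.hom_pow[OF X] H.R.nat_pow_closed[OF X] by metis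
  moreover have "map indexed_const ?X = [\<one>\<^bsub>alg_closure\<^esub>, \<ominus>\<^bsub>alg_closure\<^esub> indexed_const a]"
    using a by simp
  ultimately have "[\<one>\<^bsub>alg_closure\<^esub>, \<ominus>\<^bsub>alg_closure\<^esub> indexed_const a]
      [^]\<^bsub>poly_ring alg_closure\<^esub> alg_mult p a pdivides\<^bsub>alg_closure\<^esub> map indexed_const p"
    unfolding pdivides_def factor_def using H.hom_closed[OF q] by auto
  hence "alg_mult p a \<le> A.alg_mult (map indexed_const p) (indexed_const a)"
    using A.alg_multE(2)[OF h.hom_closed[OF a] H.hom_closed[OF p]] ne by simp
  also have "\<dots> \<le> 1"
    using sep h.hom_closed[OF a] unfolding separable_poly_def \<sigma>_def by blast
  finally show ?thesis .
qed

lemma (in field) card_roots_le_degree: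
  assumes p: "p \<in> carrier (poly_ring R)"
  shows "card {y. is_root p y} \<le> degree p"
proof -
  have "{y. is_root p y} = set_mset (roots p)"
    using roots_mem_iff_is_root[OF p] by auto
  hence "card {y. is_root p y} = (\<Sum>y\<in>set_mset (roots p). 1)"
    by simp
  also have "\<dots> \<le> (\<Sum>y\<in>set_mset (roots p). count (roots p) y)"
    by (rule sum_mono) (simp add: Suc_le_eq)
  also have "\<dots> = size (roots p)"
    by (simp add: size_multiset_overloaded_eq)
  finally show ?thesis
    using size_roots_le_degree[OF p] by simp
qed

lemma (in field) card_roots_eq_degree:
  assumes p: "p \<in> carrier (poly_ring R)" and "splitted p"
    and simple: "\<And>a. alg_mult p a \<le> 1"
  shows "card {y. is_root p y} = degree p"
proof -
  have "count (roots p) a = 1" if "a \<in># roots p" for a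
    using simple[of a] that alg_mult_eq_count_roots[OF p] count_greater_zero_iff[of "roots p" a]
    by (metis le_antisym One_nat_def Suc_leI)
  hence "size (roots p) = card (set_mset (roots p))"
    unfolding size_multiset_overloaded_eq by simp
  moreover have "set_mset (roots p) = {y. is_root p y}"
    using roots_mem_iff_is_root[OF p] by auto
  ultimately show ?thesis
    using \<open>splitted p\<close> unfolding splitted_def by simp
qed

text \<open>
  Otherwise \<open>p - a\<close> would be a nonzero polynomial with more roots than its degree.
\<close>

lemma (in field) const_on_many_points_imp_const:
  assumes p: "p \<in> carrier (poly_ring R)" and a: "a \<in> carrier R"
    and S: "S \<subseteq> carrier R" "degree p < card S" and const: "\<And>y. y \<in> S \<Longrightarrow> eval p y = a"
  shows "p = poly_of_const a"
proof (rule ccontr)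
  assume neq: "p \<noteq> poly_of_const a"
  interpret RX: cring "poly_ring R"
    using univ_poly_is_cring[OF carrier_is_subring] .
  let ?q = "p \<ominus>\<^bsub>poly_ring R\<^esub> poly_of_const a"
  have c: "poly_of_const a \<in> carrier (poly_ring R)"
    using a normalize_gives_polynomial[of "[a]" "carrier R"] univ_poly_carrier
    unfolding poly_of_const_def by auto
  have q: "?q \<in> carrier (poly_ring R)"
    using p c by simp
  have deg: "degree (poly_of_const a) = 0"
    unfolding poly_of_const_def by simp
  have "degree ?q \<le> max (degree p) (degree (\<ominus>\<^bsub>poly_ring R\<^esub> poly_of_const a))"
    unfolding a_minus_def univ_poly_add using poly_add_degree by blast
  hence deg_q: "degree ?q \<le> degree p"
    using univ_poly_a_inv_degree[OF carrier_is_subring c] deg by simp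
  have "?q \<noteq> []"
    using neq p c RX.r_right_minus_eq by (simp add: univ_poly_zero[symmetric, of R "carrier R"])
  moreover have "eval ?q y = \<zero>" if "y \<in> S" for y
  proof -
    have y: "y \<in> carrier R" using S(1) that by blast
    interpret e: ring_hom_cring "poly_ring R" R "\<lambda>p. eval p y"
      using eval_cring_hom[OF carrier_is_subring y] .
    have "eval (poly_of_const a) y = a"
      using a y eval_normalize[of "[a]" y] unfolding poly_of_const_def by simp
    thus ?thesis
      using p c const[OF that] a by (simp add: a_minus_def r_neg)
  qed
  ultimately have "S \<subseteq> {y. is_root ?q y}"
    using S(1) unfolding is_root_def by blast
  hence "card S \<le> card {y. is_root ?q y}"
    using card_mono finite_number_of_roots[OF q] by blast
  thus False
    using card_roots_le_degree[OF q] deg_q S(2) by linarith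
qed

section \<open>The Galois correspondence\<close>

locale galois_simple_extension = field L for L (structure) +
  fixes k x
  assumes base: "subfield k L"
    and gen_closed: "x \<in> carrier L"
    and primitive: "carrier L = simple_extension k x"
    and galois: "galois_extension k"
begin

abbreviation G where "G \<equiv> galois_group L k"

definition fixed_field where "fixed_field H = {a \<in> carrier L. \<forall>h\<in>H. h a = a}"

definition stabilizer where "stabilizer T = {g \<in> carrier G. \<forall>a\<in>T. g a = a}"

lemma algebraic: "algebraic_extension k"
  using galois unfolding galois_extension_def normal_extension_def by blast

lemma algebraic_over: "subfield T L \<Longrightarrow> k \<subseteq> T \<Longrightarrow> algebraic_extension T"
  using algebraic algebraic_mono unfolding algebraic_extension_def by blast

lemma primitive_over:
  assumes "subfield T L" "k \<subseteq> T"
  shows "carrier L = simple_extension T x"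
  using mono_simple_extension[OF assms(2), of x] primitive
    simple_extension_in_carrier[OF subfieldE(3)[OF assms(1)] gen_closed] by blast

lemma subalgebra_is_subfield: "T \<in> subalgebras L k \<Longrightarrow> subfield T L"
  using subring_of_algebraic_extension_is_subfield[OF base algebraic]
  unfolding subalgebras_def by blast

lemma subalgebra_closed: "T \<in> subalgebras L k \<Longrightarrow> T \<subseteq> carrier L"
  using subalgebra_is_subfield subfieldE(3) by blast

sublocale G: group G
  using group_galois_group subfieldE(3)[OF base] .

lemma automorphism:
  assumes "g \<in> carrier G"
  shows "g \<in> ring_hom L L" "bij_betw g (carrier L) (carrier L)" "g \<in> extensional (carrier L)"
    "\<And>c. c \<in> k \<Longrightarrow> g c = c" "\<And>a. a \<in> carrier L \<Longrightarrow> g a \<in> carrier L"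
  using assms bij_betw_apply unfolding carrier_galois_group ring_iso_def by auto

lemma mult_apply:
  assumes "g \<in> carrier G" "h \<in> carrier G" "a \<in> carrier L"
  shows "(g \<otimes>\<^bsub>G\<^esub> h) a = g (h a)"
proof -
  have "g \<in> Bij (carrier L)" "h \<in> Bij (carrier L)"
    using automorphism(2,3)[OF assms(1)] automorphism(2,3)[OF assms(2)] unfolding Bij_def by auto
  hence "g \<otimes>\<^bsub>G\<^esub> h = compose (carrier L) g h"
    by (simp add: galois_group_def BijGroup_def)
  thus ?thesis
    using assms(3) by (simp add: compose_def)
qed

lemma one_apply: "a \<in> carrier L \<Longrightarrow> \<one>\<^bsub>G\<^esub> a = a"
  by (simp add: galois_group_def BijGroup_def)

text \<open>
  Every element is a polynomial expression in \<open>x\<close> over \<open>k\<close>.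
\<close>

lemma automorphism_eqI:
  assumes g: "g \<in> carrier G" and h: "h \<in> carrier G" and eq: "g x = h x"
  shows "g = h"
proof (rule extensionalityI[OF automorphism(3)[OF g] automorphism(3)[OF h]])
  fix a assume "a \<in> carrier L"
  then obtain p where p: "p \<in> carrier (k[X])" "a = eval p x"
    using primitive simple_extension_as_eval_img[OF subfieldE(3)[OF base] gen_closed] by auto
  have eval_gen: "f a = eval p (f x)" if "f \<in> carrier G" for f
    using hom_fixing_eval[OF subfieldE(1)[OF base] automorphism(1,4)[OF that] p(1) gen_closed] p(2)
    by simp
  show "g a = h a"
    using eval_gen[OF g] eval_gen[OF h] eq by simp
qed

lemma Irr_over_base:
  shows "Irr k x \<in> carrier (k[X])" "Irr k x \<in> carrier (poly_ring L)" "Irr k x \<noteq> []"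
    "is_root (Irr k x) x" "splitted (Irr k x)" "alg_mult (Irr k x) a \<le> 1"
proof -
  have alg: "(algebraic over k) x"
    using algebraic gen_closed unfolding algebraic_extension_def by blast
  note irr = IrrE[OF base gen_closed alg]
  show "Irr k x \<in> carrier (k[X])"
    by (rule irr(1))
  show p: "Irr k x \<in> carrier (poly_ring L)"
    using carrier_polynomial_shell[OF subfieldE(1)[OF base] irr(1)] .
  show "Irr k x \<noteq> []"
    using pirreducibleE(1)[OF subfieldE(1)[OF base] irr(1,2)] .
  thus root: "is_root (Irr k x) x"
    using irr(4) gen_closed unfolding is_root_def by simp
  show "splitted (Irr k x)"
    using galois irr(1,2) root unfolding galois_extension_def normal_extension_def by blast
  show "alg_mult (Irr k x) a \<le> 1"
    using alg_mult_le_1_of_separable_poly[OF p] galois gen_closed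
    unfolding galois_extension_def separable_extension_def by blast
qed

lemma finite_galois_group: "finite (carrier G)"
proof (rule inj_on_finite)
  show "inj_on (\<lambda>g. g x) (carrier G)"
    using automorphism_eqI by (auto intro: inj_onI)
  show "finite {y. is_root (Irr k x) y}"
    using finite_number_of_roots[OF Irr_over_base(2)] .
  show "(\<lambda>g. g x) ` carrier G \<subseteq> {y. is_root (Irr k x) y}"
  proof clarify
    fix g assume g: "g \<in> carrier G"
    have "eval (Irr k x) (g x) = g (eval (Irr k x) x)"
      using hom_fixing_eval[OF subfieldE(1)[OF base] automorphism(1,4)[OF g] Irr_over_base(1) gen_closed]
      by simp
    also have "\<dots> = \<zero>"
      using Irr_over_base(4) ring_hom_zero[OF automorphism(1)[OF g] ring_axioms ring_axioms]
      unfolding is_root_def by simp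
    finally show "is_root (Irr k x) (g x)"
      using Irr_over_base(3) automorphism(5)[OF g gen_closed] unfolding is_root_def by simp
  qed
qed

lemma fixed_field_subalgebra:
  assumes "H \<subseteq> carrier G"
  shows "fixed_field H \<in> subalgebras L k"
proof -
  have "subring (fixed_field H) L"
  proof (rule subringI)
    show "\<one> \<in> fixed_field H"
      using assms ring_hom_one[OF automorphism(1)] unfolding fixed_field_def by auto
    fix a assume a: "a \<in> fixed_field H"
    have "h (\<ominus> a) = \<ominus> a" if h: "h \<in> H" for h
    proof -
      interpret h: ring_hom_ring L L h
        using ring_hom_ringI2[OF ring_axioms ring_axioms automorphism(1)] assms h by blast
      have "a \<in> carrier L" "h a = a"
        using a h unfolding fixed_field_def by auto
      thus ?thesis
        by simp
    qed
    thus "\<ominus> a \<in> fixed_field H"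
      using a unfolding fixed_field_def by simp
    fix b assume b: "b \<in> fixed_field H"
    have "h (a \<otimes> b) = a \<otimes> b" "h (a \<oplus> b) = a \<oplus> b" if h: "h \<in> H" for h
    proof -
      have hom: "h \<in> ring_hom L L"
        using automorphism(1) assms h by blast
      have "a \<in> carrier L" "h a = a" "b \<in> carrier L" "h b = b"
        using a b h unfolding fixed_field_def by auto
      thus "h (a \<otimes> b) = a \<otimes> b" "h (a \<oplus> b) = a \<oplus> b"
        using ring_hom_mult[OF hom, of a b] ring_hom_add[OF hom, of a b] by simp_all
    qed
    thus "a \<otimes> b \<in> fixed_field H" "a \<oplus> b \<in> fixed_field H"
      using a b unfolding fixed_field_def by simp_all
  qed (auto simp: fixed_field_def)
  moreover have "k \<subseteq> fixed_field H"
    using assms automorphism(4) subfieldE(3)[OF base] unfolding fixed_field_def by blast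
  ultimately show ?thesis
    unfolding subalgebras_def by blast
qed

lemma stabilizer_subgroup:
  assumes "T \<subseteq> carrier L"
  shows "subgroup (stabilizer T) G"
proof (rule G.subgroupI)
  show "stabilizer T \<subseteq> carrier G"
    unfolding stabilizer_def by blast
  have "\<one>\<^bsub>G\<^esub> \<in> stabilizer T"
    using assms one_apply unfolding stabilizer_def by auto
  thus "stabilizer T \<noteq> {}"
    by blast
next
  fix g assume g: "g \<in> stabilizer T"
  hence gG: "g \<in> carrier G" unfolding stabilizer_def by blast
  have "(inv\<^bsub>G\<^esub> g) a = a" if a: "a \<in> T" for a
  proof -
    have "(inv\<^bsub>G\<^esub> g) (g a) = a"
      using mult_apply[of "inv\<^bsub>G\<^esub> g" g a] one_apply assms a gG by auto
    thus ?thesis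
      using g a unfolding stabilizer_def by simp
  qed
  thus "inv\<^bsub>G\<^esub> g \<in> stabilizer T"
    using gG unfolding stabilizer_def by simp
next
  fix g h assume "g \<in> stabilizer T" "h \<in> stabilizer T"
  thus "g \<otimes>\<^bsub>G\<^esub> h \<in> stabilizer T"
    using assms mult_apply unfolding stabilizer_def by auto
qed

text \<open>
  The minimal polynomial \<open>q\<close> of \<open>x\<close> over \<open>T\<close> divides the one over \<open>k\<close>, which splits with
  simple roots; so \<open>q\<close> has \<open>degree q\<close> roots, each the image of \<open>x\<close> under some automorphism over \<open>T\<close>. Write a fixed
  element \<open>a\<close> as \<open>r(x)\<close> with \<open>r\<close> over \<open>T\<close> of degree less than \<open>degree q\<close>. Applying the automorphisms
  shows that \<open>r\<close> takes the value \<open>a\<close> at all roots of \<open>q\<close>, so \<open>r\<close> is the constant \<open>a\<close>.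
\<close>

lemma fixed_field_stabilizer:
  assumes T: "T \<in> subalgebras L k"
  shows "fixed_field (stabilizer T) = T"
proof
  show "T \<subseteq> fixed_field (stabilizer T)"
    using subalgebra_closed[OF T] unfolding fixed_field_def stabilizer_def by blast
next
  have fT: "subfield T L" and kT: "k \<subseteq> T"
    using subalgebra_is_subfield T unfolding subalgebras_def by auto
  note sT = subfieldE(1)[OF fT]
  have algT: "algebraic_extension T"
    using algebraic_over[OF fT kT] .
  hence alg: "(algebraic over T) x"
    using gen_closed unfolding algebraic_extension_def by blast
  let ?q = "Irr T x"
  note q = IrrE[OF fT gen_closed alg]
  have qL: "?q \<in> carrier (poly_ring L)"
    using carrier_polynomial_shell[OF sT q(1)] .
  have q_ne: "?q \<noteq> []"
    using pirreducibleE(1)[OF sT q(1,2)] .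
  have "Irr k x \<in> carrier (T[X])"
    using Irr_over_base(1) kT unfolding univ_poly_carrier[symmetric] polynomial_def by auto
  hence q_dvd: "?q pdivides Irr k x"
    using Irr_minimal[OF fT gen_closed alg] Irr_over_base(4) unfolding is_root_def by blast
  have "alg_mult ?q a \<le> 1" for a
    using pdivides_imp_roots_incl[OF qL Irr_over_base(2,3) q_dvd] Irr_over_base(6)[of a]
      alg_mult_eq_count_roots[OF qL] alg_mult_eq_count_roots[OF Irr_over_base(2)]
      mset_subset_eq_count[of "roots ?q" "roots (Irr k x)" a] by simp
  hence card_roots: "card {y. is_root ?q y} = degree ?q"
    using card_roots_eq_degree[OF qL pdivides_imp_splitted[OF qL Irr_over_base(2,3,5) q_dvd]] by blast
  show "fixed_field (stabilizer T) \<subseteq> T"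
  proof
    fix a assume a: "a \<in> fixed_field (stabilizer T)"
    hence aL: "a \<in> carrier L"
      unfolding fixed_field_def by blast
    then obtain p where p: "p \<in> carrier (T[X])" "a = eval p x"
      using primitive_over[OF fT kT] simple_extension_as_eval_img[OF subfieldE(3)[OF fT] gen_closed]
      by auto
    let ?r = "pmod p ?q"
    have r: "?r \<in> carrier (T[X])"
      using long_division_closed(2)[OF fT p(1) q(1)] .
    interpret ex: ring_hom_cring "T[X]" L "\<lambda>p. eval p x"
      using eval_cring_hom[OF sT gen_closed] .
    have "eval p x = eval (?q \<otimes>\<^bsub>T[X]\<^esub> (pdiv p ?q) \<oplus>\<^bsub>T[X]\<^esub> ?r) x"
      using pdiv_pmod[OF fT p(1) q(1)] by simp
    also have "\<dots> = eval ?r x"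
      using long_division_closed[OF fT p(1) q(1)] q(1,4) by simp
    finally have ra: "eval ?r x = a"
      using p(2) by simp
    have "eval ?r y = a" if y: "is_root ?q y" for y
    proof -
      obtain g where g: "g \<in> carrier (galois_group L T)" "g x = y"
        using exists_automorphism_to_conjugate[OF fT algT gen_closed primitive_over[OF fT kT] y]
        by blast
      have gT: "g \<in> ring_hom L L" "\<And>c. c \<in> T \<Longrightarrow> g c = c"
        using g(1) unfolding carrier_galois_group ring_iso_def by auto
      have "g \<in> stabilizer T"
        using g(1) kT unfolding stabilizer_def carrier_galois_group by auto
      hence "g a = a"
        using a unfolding fixed_field_def by blast
      thus ?thesis
        using hom_fixing_eval[OF sT gT r gen_closed] ra g(2) by simp
    qed
    moreover have "degree ?r < degree ?q"
      using pmod_degree[OF fT p(1) q(1) q_ne] pirreducible_degree[OF fT q(1,2)] by auto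
    ultimately have "?r = poly_of_const a"
      using const_on_many_points_imp_const[OF carrier_polynomial_shell[OF sT r] aL,
          of "{y. is_root ?q y}"] card_roots unfolding is_root_def by auto
    hence "a = \<zero> \<or> ?r = [a]"
      unfolding poly_of_const_def by auto
    thus "a \<in> T"
    proof
      assume "a = \<zero>"
      thus "a \<in> T" using subringE(2)[OF sT] by simp
    next
      assume "?r = [a]"
      hence "[a] \<in> carrier (T[X])"
        using r by (rule back_subst[of "\<lambda>p. p \<in> carrier (T[X])", rotated])
      thus "a \<in> T"
        unfolding univ_poly_carrier[symmetric] polynomial_def by simp
    qed
  qed
qed

text \<open>
  The polynomial \<open>P\<close>, the product of all \<open>X - h x\<close> with \<open>h \<in> H\<close>, is unchanged when an element of \<open>H\<close>
  acts on its coefficients, since this only permutes the factors. Hence its coefficients lie in the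
  fixed field of \<open>H\<close>, and an automorphism \<open>s\<close> over that field maps the root \<open>x\<close> of \<open>P\<close> to a root
  \<open>h x\<close>; as automorphisms are determined by their value at \<open>x\<close>, \<open>s = h\<close>.
\<close>

lemma stabilizer_fixed_field:
  assumes H: "subgroup H G"
  shows "stabilizer (fixed_field H) = H"
proof
  show "H \<subseteq> stabilizer (fixed_field H)"
    using subgroup.subset[OF H] unfolding fixed_field_def stabilizer_def by blast
next
  have HG: "H \<subseteq> carrier G"
    using subgroup.subset[OF H] .
  have finH: "finite H"
    using finite_subset[OF HG finite_galois_group] .
  interpret LX: cring "poly_ring L"
    using univ_poly_is_cring[OF carrier_is_subring] .
  define f where "f h = [\<one>, \<ominus> h x]" for h
  define P where "P = finprod (poly_ring L) f H"
  have hx: "h x \<in> carrier L" if "h \<in> H" for h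
    using automorphism(5) gen_closed HG that by blast
  have f: "f \<in> H \<rightarrow> carrier (poly_ring L)"
    using monic_linear_in_carrier hx unfolding f_def by blast
  have P: "P \<in> carrier (poly_ring L)"
    unfolding P_def using LX.finprod_closed[OF f] .
  have map_P: "map s P = P" if s: "s \<in> H" for s
  proof -
    have sG: "s \<in> carrier G" using s HG by blast
    interpret s: ring_hom_ring L L s
      using ring_hom_ringI2[OF ring_axioms ring_axioms automorphism(1)[OF sG]] .
    interpret sX: ring_hom_cring "poly_ring L" "poly_ring L" "map s"
      using map_poly_ring_hom[OF automorphism(1)[OF sG] field_axioms field_axioms] .
    have "map s P = finprod (poly_ring L) (map s \<circ> f) H"
      unfolding P_def using sX.hom_finprod[OF f] .
    also have "\<dots> = finprod (poly_ring L) (\<lambda>h. f (s \<otimes>\<^bsub>G\<^esub> h)) H"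
    proof (rule LX.finprod_cong'[OF refl])
      show "(\<lambda>h. f (s \<otimes>\<^bsub>G\<^esub> h)) \<in> H \<rightarrow> carrier (poly_ring L)"
        using f subgroup.m_closed[OF H s] by blast
      show "(map s \<circ> f) h = f (s \<otimes>\<^bsub>G\<^esub> h)" if "h \<in> H" for h
        using hx[OF that] mult_apply[OF sG _ gen_closed, of h] HG that unfolding f_def by auto
    qed
    also have "\<dots> = finprod (poly_ring L) f ((\<lambda>h. s \<otimes>\<^bsub>G\<^esub> h) ` H)"
    proof (rule LX.finprod_reindex[symmetric])
      show "f \<in> (\<lambda>h. s \<otimes>\<^bsub>G\<^esub> h) ` H \<rightarrow> carrier (poly_ring L)"
        using f subgroup.m_closed[OF H s] by blast
      show "inj_on (\<lambda>h. s \<otimes>\<^bsub>G\<^esub> h) H"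
        using inj_on_subset[OF G.inj_on_cmult[OF sG] HG] .
    qed
    also have "(\<lambda>h. s \<otimes>\<^bsub>G\<^esub> h) ` H = H"
      using endo_inj_surj[OF finH _ inj_on_subset[OF G.inj_on_cmult[OF sG] HG]]
        subgroup.m_closed[OF H s] by blast
    finally show ?thesis
      unfolding P_def .
  qed
  have "fixed_field H \<in> subalgebras L k"
    using fixed_field_subalgebra[OF HG] .
  hence subF: "subring (fixed_field H) L"
    unfolding subalgebras_def by blast
  have set_P: "set P \<subseteq> carrier L"
    using P polynomial_incl univ_poly_carrier by blast
  have "s c = c" if "c \<in> set P" "s \<in> H" for c s
    using map_P[OF that(2)] that(1) map_eq_conv[of s P id] by simp
  hence "set P \<subseteq> fixed_field H"
    using set_P unfolding fixed_field_def by blast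
  hence PF: "P \<in> carrier ((fixed_field H)[X])"
    using P unfolding univ_poly_carrier[symmetric] polynomial_def by auto
  have eval_P: "eval P y = (\<Otimes>h\<in>H. y \<ominus> h x)" if y: "y \<in> carrier L" for y
  proof -
    interpret ey: ring_hom_cring "poly_ring L" L "\<lambda>p. eval p y"
      using eval_cring_hom[OF carrier_is_subring y] .
    have "eval P y = finprod L ((\<lambda>p. eval p y) \<circ> f) H"
      unfolding P_def using ey.hom_finprod[OF f] .
    also have "\<dots> = (\<Otimes>h\<in>H. y \<ominus> h x)"
      using y hx by (intro finprod_cong') (auto simp: f_def a_minus_def)
    finally show ?thesis .
  qed
  have root_P: "eval P y = \<zero> \<longleftrightarrow> (\<exists>h\<in>H. y = h x)" if y: "y \<in> carrier L" for y
  proof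
    assume "eval P y = \<zero>"
    then obtain h where h: "h \<in> H" "y \<ominus> h x = \<zero>"
      using finprod_eq_zero_imp_factor_zero[OF finH, of "\<lambda>h. y \<ominus> h x"] eval_P[OF y] y hx by auto
    thus "\<exists>h\<in>H. y = h x"
      using r_right_minus_eq[OF y hx] by blast
  next
    assume "\<exists>h\<in>H. y = h x"
    then obtain h where h: "h \<in> H" "y = h x" by blast
    have "(\<Otimes>h\<in>H. y \<ominus> h x) = (y \<ominus> h x) \<otimes> (\<Otimes>h\<in>H - {h}. y \<ominus> h x)"
      using finH h(1) y hx by (subst insert_Diff[OF h(1), symmetric], subst finprod_insert) auto
    also have "\<dots> = \<zero>"
      using h y hx by (simp add: a_minus_def r_neg Pi_def)
    finally show "eval P y = \<zero>"
      using eval_P[OF y] by simp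
  qed
  show "stabilizer (fixed_field H) \<subseteq> H"
  proof
    fix s assume "s \<in> stabilizer (fixed_field H)"
    hence s: "s \<in> carrier G" "\<And>c. c \<in> fixed_field H \<Longrightarrow> s c = c"
      unfolding stabilizer_def by auto
    have "eval P x = \<zero>"
      using root_P[OF gen_closed] subgroup.one_closed[OF H] one_apply[OF gen_closed] by metis
    hence "eval P (s x) = \<zero>"
      using hom_fixing_eval[OF subF automorphism(1)[OF s(1)] s(2) PF gen_closed]
        ring_hom_zero[OF automorphism(1)[OF s(1)] ring_axioms ring_axioms] by simp
    then obtain h where "h \<in> H" "s x = h x"
      using root_P[OF automorphism(5)[OF s(1) gen_closed]] by blast
    thus "s \<in> H"
      using automorphism_eqI[OF s(1), of h] HG by blast
  qed
qed

section \<open>Distributivity and cyclicity\<close>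

lemma stabilizer_antimono: "T \<subseteq> U \<Longrightarrow> stabilizer U \<subseteq> stabilizer T"
  unfolding stabilizer_def by blast

lemma fixed_field_Un: "fixed_field (A \<union> B) = fixed_field A \<inter> fixed_field B"
  unfolding fixed_field_def by blast

lemma stabilizer_join:
  assumes T: "T \<in> subalgebras L k" and U: "U \<in> subalgebras L k"
  shows "stabilizer (generate_ring L (T \<union> U)) = stabilizer T \<inter> stabilizer U"
proof
  have TU: "T \<union> U \<subseteq> carrier L"
    using subalgebra_closed T U by blast
  show "stabilizer (generate_ring L (T \<union> U)) \<subseteq> stabilizer T \<inter> stabilizer U"
    using stabilizer_antimono generate_ringE(2)[OF TU refl] by blast
  show "stabilizer T \<inter> stabilizer U \<subseteq> stabilizer (generate_ring L (T \<union> U))"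
  proof
    fix g assume g: "g \<in> stabilizer T \<inter> stabilizer U"
    hence gG: "g \<in> carrier G"
      unfolding stabilizer_def by blast
    have "subring (fixed_field {g}) L"
      using fixed_field_subalgebra[of "{g}"] gG unfolding subalgebras_def by simp
    moreover have "T \<union> U \<subseteq> fixed_field {g}"
      using g TU unfolding fixed_field_def stabilizer_def by blast
    ultimately have "generate_ring L (T \<union> U) \<subseteq> fixed_field {g}"
      using generate_ring_min_subring1[OF TU] by blast
    thus "g \<in> stabilizer (generate_ring L (T \<union> U))"
      using gG unfolding fixed_field_def stabilizer_def by blast
  qed
qed

lemma join_closed:
  assumes "T \<in> subalgebras L k" "U \<in> subalgebras L k"
  shows "generate_ring L (T \<union> U) \<in> subalgebras L k"
  using subalgebra_order_least[OF assms]
  unfolding least_def Upper_def subalgebra_order_def by auto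

lemma meet_closed:
  assumes "T \<in> subalgebras L k" "U \<in> subalgebras L k"
  shows "T \<inter> U \<in> subalgebras L k"
  using subalgebra_order_greatest[OF assms]
  unfolding greatest_def Lower_def subalgebra_order_def by auto

lemma distributive_iff:
  "distributive_extension L k \<longleftrightarrow>
    (\<forall>T\<in>subalgebras L k. \<forall>U\<in>subalgebras L k. \<forall>V\<in>subalgebras L k.
      T \<inter> generate_ring L (U \<union> V) = generate_ring L (T \<inter> U \<union> T \<inter> V))"
proof -
  have carrier: "carrier (subalgebra_order L k) = subalgebras L k"
    by (simp add: subalgebra_order_def)
  show ?thesis
    unfolding distributive_extension_def distributive_lattice_def carrier
    using lattice_subalgebra_order
    by (simp add: meet_subalgebra_order join_subalgebra_order join_closed meet_closed)
qed

text \<open>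
  In an abelian group the join of two subgroups is their product, so the correspondence turns the
  intersection of intermediate fields into \<open><#>\<close> and the compositum into the intersection of
  stabilizers. The nontrivial inclusion becomes the distributivity of subgroups of \<open>G\<close>.
\<close>

lemma cyclic_imp_distributive:
  assumes "cyclic_group G"
  shows "distributive_extension L k"
  unfolding distributive_iff
proof (intro ballI equalityI)
  fix T U V
  assume T: "T \<in> subalgebras L k" and U: "U \<in> subalgebras L k" and V: "V \<in> subalgebras L k"
  note sub = stabilizer_subgroup[OF subalgebra_closed]
  have TU: "T \<inter> U \<in> subalgebras L k" and TV: "T \<inter> V \<in> subalgebras L k"
    using meet_closed T U V by auto
  interpret comm_group G
    using G.cyclic_imp_abelian_group[OF assms] .
  have stabilizer_meet: "stabilizer (T \<inter> W) = stabilizer T <#>\<^bsub>G\<^esub> stabilizer W" if W: "W \<in> subalgebras L k" for W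
  proof -
    let ?P = "stabilizer T <#>\<^bsub>G\<^esub> stabilizer W"
    have P: "subgroup ?P G"
      using mult_subgroups[OF sub[OF T] sub[OF W]] .
    have "fixed_field ?P \<subseteq> fixed_field (stabilizer T \<union> stabilizer W)"
      using G.Un_subset_set_mult[OF sub[OF T] sub[OF W]] unfolding fixed_field_def by blast
    hence "fixed_field ?P \<subseteq> T \<inter> W"
      unfolding fixed_field_Un using fixed_field_stabilizer T W by simp
    hence "stabilizer (T \<inter> W) \<subseteq> ?P"
      using stabilizer_antimono stabilizer_fixed_field[OF P] by blast
    moreover have "?P \<subseteq> stabilizer (T \<inter> W)"
      using subgroup.m_closed[OF sub[OF meet_closed[OF T W]]]
        stabilizer_antimono[of "T \<inter> W" T] stabilizer_antimono[of "T \<inter> W" W]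
      unfolding set_mult_def by blast
    ultimately show ?thesis
      by blast
  qed
  show "generate_ring L (T \<inter> U \<union> T \<inter> V) \<subseteq> T \<inter> generate_ring L (U \<union> V)"
  proof (rule generate_ring_min_subring1)
    show "T \<inter> U \<union> T \<inter> V \<subseteq> carrier L"
      using subalgebra_closed[OF T] by blast
    show "subring (T \<inter> generate_ring L (U \<union> V)) L"
      using meet_closed[OF T join_closed[OF U V]] unfolding subalgebras_def by blast
    show "T \<inter> U \<union> T \<inter> V \<subseteq> T \<inter> generate_ring L (U \<union> V)"
      by (auto intro: generate_ring.incl)
  qed
  have "stabilizer (generate_ring L (T \<inter> U \<union> T \<inter> V)) = stabilizer (T \<inter> U) \<inter> stabilizer (T \<inter> V)"
    using stabilizer_join[OF TU TV] .
  also have "\<dots> \<subseteq> stabilizer T <#>\<^bsub>G\<^esub> (stabilizer U \<inter> stabilizer V)"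
    unfolding stabilizer_meet[OF U] stabilizer_meet[OF V]
    using G.cyclic_subgroups_distrib[OF assms sub[OF T] sub[OF U] sub[OF V]] .
  also have "\<dots> = stabilizer T <#>\<^bsub>G\<^esub> stabilizer (generate_ring L (U \<union> V))"
    using stabilizer_join[OF U V] by simp
  also have "\<dots> = stabilizer (T \<inter> generate_ring L (U \<union> V))"
    using stabilizer_meet[OF join_closed[OF U V]] by simp
  finally have "fixed_field (stabilizer (T \<inter> generate_ring L (U \<union> V)))
      \<subseteq> fixed_field (stabilizer (generate_ring L (T \<inter> U \<union> T \<inter> V)))"
    unfolding fixed_field_def by blast
  thus "T \<inter> generate_ring L (U \<union> V) \<subseteq> generate_ring L (T \<inter> U \<union> T \<inter> V)"
    using fixed_field_stabilizer[OF meet_closed[OF T join_closed[OF U V]]] fixed_field_stabilizer[OF join_closed[OF TU TV]]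
    by simp
qed

text \<open>
  Write \<open>F g\<close> for the fixed field of the subgroup generated by \<open>g\<close>, and \<open>c\<close> for the product of \<open>a\<close>
  and \<open>b\<close>. Since \<open>F a \<inter> F b \<subseteq> F c\<close>, expanding the intersection of the composita of \<open>F c\<close> with \<open>F a\<close>
  and with \<open>F b\<close> by the distributive law, twice, bounds it by \<open>F c\<close>. A compositum
  of \<open>F c\<close> and \<open>F g\<close> is the fixed field of the intersection of the two cyclic subgroups, so under
  the correspondence this bound is the hypothesis of \<open>product_split_imp_cyclic\<close>.
\<close>

lemma distributive_imp_cyclic:
  assumes "distributive_extension L k"
  shows "cyclic_group G"
proof (rule G.product_split_imp_cyclic[OF finite_galois_group])
  have distrib: "T \<inter> generate_ring L (U \<union> V) = generate_ring L (T \<inter> U \<union> T \<inter> V)"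
    if "T \<in> subalgebras L k" "U \<in> subalgebras L k" "V \<in> subalgebras L k" for T U V
    using assms[unfolded distributive_iff, rule_format, OF that] .
  fix a b assume a: "a \<in> carrier G" and b: "b \<in> carrier G"
  let ?c = "a \<otimes>\<^bsub>G\<^esub> b"
  let ?gen = "\<lambda>g. generate G {g}"
  have c: "?c \<in> carrier G"
    using a b by simp
  have gen: "subgroup (?gen g) G" if "g \<in> carrier G" for g
    using G.generate_is_subgroup[of "{g}"] that by simp
  have gen_mem: "g \<in> ?gen g" for g
    by (simp add: generate.incl)
  define F where "F g = fixed_field (?gen g)" for g
  have F: "F g \<in> subalgebras L k" if "g \<in> carrier G" for g
    unfolding F_def using fixed_field_subalgebra[OF subgroup.subset[OF gen[OF that]]] .
  have stabilizer_F: "stabilizer (F g) = ?gen g" if "g \<in> carrier G" for g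
    unfolding F_def using stabilizer_fixed_field[OF gen[OF that]] .
  define H where "H = generate G (?gen ?c \<inter> ?gen a \<union> ?gen ?c \<inter> ?gen b)"
  have "?gen ?c \<inter> ?gen a \<union> ?gen ?c \<inter> ?gen b \<subseteq> carrier G"
    using subgroup.subset[OF gen[OF c]] by blast
  hence H: "subgroup H G" and H_incl: "?gen ?c \<inter> ?gen a \<union> ?gen ?c \<inter> ?gen b \<subseteq> H"
    unfolding H_def using G.generate_is_subgroup by (auto intro: generate.incl)
  have join: "generate_ring L (F ?c \<union> F g) = fixed_field (?gen ?c \<inter> ?gen g)" if "g \<in> carrier G" for g
    using fixed_field_stabilizer[OF join_closed[OF F[OF c] F[OF that]]] stabilizer_join[OF F[OF c] F[OF that]]
      stabilizer_F[OF c] stabilizer_F[OF that] by simp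
  have ab_in_c: "F a \<inter> F b \<subseteq> F ?c"
  proof -
    have "?c \<in> stabilizer (F a \<inter> F b)"
      using subgroup.m_closed[OF stabilizer_subgroup[OF subalgebra_closed[OF meet_closed[OF F[OF a] F[OF b]]]]]
        stabilizer_antimono[of "F a \<inter> F b" "F a"] stabilizer_antimono[of "F a \<inter> F b" "F b"]
        stabilizer_F[OF a] stabilizer_F[OF b] gen_mem by blast
    hence "?gen ?c \<subseteq> stabilizer (F a \<inter> F b)"
      using G.generate_subgroup_incl[of "{?c}"]
        stabilizer_subgroup[OF subalgebra_closed[OF meet_closed[OF F[OF a] F[OF b]]]] by blast
    hence "fixed_field (stabilizer (F a \<inter> F b)) \<subseteq> F ?c"
      unfolding F_def fixed_field_def by blast
    thus ?thesis
      using fixed_field_stabilizer[OF meet_closed[OF F[OF a] F[OF b]]] by simp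
  qed
  let ?J = "\<lambda>g. generate_ring L (F ?c \<union> F g)"
  have J: "?J g \<in> subalgebras L k" if "g \<in> carrier G" for g
    using join_closed[OF F[OF c] F[OF that]] .
  have sub_F: "subring (F ?c) L"
    using F[OF c] unfolding subalgebras_def by blast
  have "fixed_field H \<subseteq> ?J a \<inter> ?J b"
    unfolding join[OF a] join[OF b] using H_incl unfolding fixed_field_def by blast
  also have "\<dots> = generate_ring L (?J a \<inter> F ?c \<union> ?J a \<inter> F b)"
    using distrib[OF J[OF a] F[OF c] F[OF b]] .
  also have "\<dots> \<subseteq> F ?c"
  proof (rule generate_ring_min_subring1[OF _ sub_F])
    have "?J a \<inter> F b = F b \<inter> ?J a" by blast
    also have "\<dots> = generate_ring L (F b \<inter> F ?c \<union> F b \<inter> F a)"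
      using distrib[OF F[OF b] F[OF c] F[OF a]] .
    also have "\<dots> \<subseteq> F ?c"
      using ab_in_c subalgebra_closed[OF F[OF b]]
      by (intro generate_ring_min_subring1[OF _ sub_F]) auto
    finally show "?J a \<inter> F ?c \<union> ?J a \<inter> F b \<subseteq> F ?c"
      by blast
    show "?J a \<inter> F ?c \<union> ?J a \<inter> F b \<subseteq> carrier L"
      using subalgebra_closed[OF J[OF a]] by blast
  qed
  finally have "stabilizer (F ?c) \<subseteq> stabilizer (fixed_field H)"
    by (rule stabilizer_antimono)
  hence "?gen ?c \<subseteq> H"
    using stabilizer_F[OF c] stabilizer_fixed_field[OF H] by simp
  thus "?c \<in> generate G (?gen ?c \<inter> ?gen a \<union> ?gen ?c \<inter> ?gen b)"
    using gen_mem unfolding H_def by blast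
qed

end

theorem proposition9p12:
  fixes L :: "('a, 'b) ring_scheme" and k :: "'a set" and x :: 'a
  assumes "field L"
    and "subfield k L"
    and "ring.finite_dimension L k (carrier L)"
    and "x \<in> carrier L"
    and "carrier L = ring.simple_extension L k x"
    and "field.galois_extension L k"
  shows "distributive_extension L k \<longleftrightarrow> cyclic_group (galois_group L k)"
proof -
  interpret galois_simple_extension L k x
    using assms by (intro galois_simple_extension.intro galois_simple_extension_axioms.intro)
  show ?thesis
    using cyclic_imp_distributive distributive_imp_cyclic by blast
qed

end
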